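(* For any Lévy process $X$, the following formulae hold for any $t>0$: $$\mathbb{E}[\overline\tau_t(X)]=\int_0^t\mathbb{P}(X_s>0)\,\mathrm{d}s\qquad\text{and}\qquad \mathbb{E}[\overline X_t]=\int_0^t\frac{\mathbb{E}\max\{X_s,0\}}{s}\,\mathrm{d}s.$$
   Context: A Lévy process $X=(X_t)_{t\ge0}$ is real-valued with stationary independent increments and càdlàg paths, started at zero; it is assumed not identically equal to zero. $\overline X_t:=\sup_{s\le t}X_s$ and $\overline\tau_t(X):=\inf\{s\in[0,t]:\max\{X_s,X_{s-}\}=\overline X_t\}$, where $X_{s-}:=\lim_{r\uparrow s}X_r$ for $s>0$ and $X_{0-}:=X_0$. Expectations of non-negative variables take values in $[0,\infty]$. *)

theory Defs
  imports "HOL-Probability.Probability"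
begin

text \<open>Paths are functions on \<^typ>\<open>real\<close>; only their values at times \<open>t \<ge> 0\<close> are ever used.\<close>

definition cadlag :: "(real \<Rightarrow> real) \<Rightarrow> bool" where
  "cadlag f \<longleftrightarrow>
     (\<forall>t\<ge>0. (f \<longlongrightarrow> f t) (at_right t)) \<and>
     (\<forall>t>0. \<exists>l. (f \<longlongrightarrow> l) (at_left t))"

text \<open>
  The stationarity clause says that the law of an increment depends only on the length of the
  time interval. The last assumption excludes processes indistinguishable from \<open>0\<close>.
\<close>

locale levy_process = prob_space M
  for M :: "'a measure" and X :: "real \<Rightarrow> 'a \<Rightarrow> real" +
  assumes random_variable: "\<And>t. 0 \<le> t \<Longrightarrow> X t \<in> borel_measurable M"
    and start_zero: "\<And>\<omega>. \<omega> \<in> space M \<Longrightarrow> X 0 \<omega> = 0"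
    and cadlag_paths: "\<And>\<omega>. \<omega> \<in> space M \<Longrightarrow> cadlag (\<lambda>t. X t \<omega>)"
    and independent_increments:
      "\<And>(n::nat) (u::nat \<Rightarrow> real). 0 \<le> u 0 \<Longrightarrow> (\<And>i. i < n \<Longrightarrow> u i < u (Suc i)) \<Longrightarrow>
         indep_vars (\<lambda>_. borel) (\<lambda>i \<omega>. X (u (Suc i)) \<omega> - X (u i) \<omega>) {..<n}"
    and stationary_increments:
      "\<And>s h. 0 \<le> s \<Longrightarrow> 0 \<le> h \<Longrightarrow>
         distr M borel (\<lambda>\<omega>. X (s + h) \<omega> - X s \<omega>) = distr M borel (\<lambda>\<omega>. X h \<omega> - X 0 \<omega>)"
    and not_identically_zero: "\<not> (AE \<omega> in M. \<forall>t\<ge>0. X t \<omega> = 0)"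

definition left_limit :: "(real \<Rightarrow> real) \<Rightarrow> real \<Rightarrow> real" where
  "left_limit f s = (if s > 0 then Lim (at_left s) f else f 0)"

text \<open>
  For a cadlag path the supremum below is over a nonempty bounded set and the infimum over a
  nonempty set, so the real-valued \<^const>\<open>Sup\<close> and \<^const>\<open>Inf\<close> are the genuine ones.
\<close>

definition running_sup :: "(real \<Rightarrow> 'a \<Rightarrow> real) \<Rightarrow> real \<Rightarrow> 'a \<Rightarrow> real" where
  "running_sup X t \<omega> = (SUP s\<in>{0..t}. X s \<omega>)"

definition time_of_sup :: "(real \<Rightarrow> 'a \<Rightarrow> real) \<Rightarrow> real \<Rightarrow> 'a \<Rightarrow> real" where
  "time_of_sup X t \<omega> =
     Inf {s \<in> {0..t}. max (X s \<omega>) (left_limit (\<lambda>r. X r \<omega>) s) = running_sup X t \<omega>}"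

end

theory Submission
  imports Defs "HOL-Number_Theory.Cong"
begin

text \<open>Subtract a drift \<open>c * s\<close> from the process and let \<open>\<phi> c\<close> be the supremum over \<open>{0..t}\<close> of
\<open>X s - c * s\<close>. Both formulae are limits of a single identity, valid for every \<open>c \<ge> 0\<close>
(\<open>expected_sup_loss\<close>): the expectation of \<open>\<phi> 0 - \<phi> c\<close> equals the integral over \<open>{0<..t}\<close> of the
expectation of \<open>(max (X s) 0 - max (X s - c * s) 0) / s\<close>. All variables in it are bounded, by \<open>c * t\<close>
and by \<open>c\<close>, and so it makes sense even for processes without a first moment.

Formally the identity is the difference of the second formula for the process and for its drifted
version. It is proved on a grid, where the process is a random walk with i.i.d. steps. There it is
the difference of two instances of Spitzer's identity, which follows from the invariance of i.i.d.
steps under cyclic shifts and from a pathwise identity summed over the shifts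
(\<open>cyclic_walk_max_increment\<close>, \<open>spitzer_drift_difference\<close>). As the mesh tends to \<open>0\<close>, the grid maxima
converge to the suprema and the sums, being right Riemann sums of a bounded right-continuous
function, converge to the integral (\<open>grid_max_tendsto_sup\<close>, \<open>right_riemann_sum_tendsto\<close>).

As \<open>c\<close> tends to infinity, \<open>\<phi> c\<close> decreases to \<open>0\<close> and monotone convergence gives the formula for the
supremum. As \<open>c\<close> tends to \<open>0\<close>, the quotient \<open>(\<phi> 0 - \<phi> c) / c\<close> tends to the first time of the
supremum, by an envelope argument on each path (\<open>drifted_sup_slope\<close>), while the integrand divided by \<open>c\<close>
tends to the probability of \<open>X s > 0\<close>; dominated convergence gives the formula for the time. That the
right derivative of \<open>\<phi>\<close> selects the first among possibly several times of the supremum mirrors the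
strict inequality in \<open>X s > 0\<close>.\<close>

section \<open>Maxima of random walks and Spitzer's identity\<close>

primrec walk_max :: "nat \<Rightarrow> (nat \<Rightarrow> real) \<Rightarrow> real" where
  "walk_max 0 x = 0"
| "walk_max (Suc n) x = max (walk_max n x) (\<Sum>i<Suc n. x i)"

lemma partial_sum_le_walk_max: "k \<le> n \<Longrightarrow> (\<Sum>i<k. x i) \<le> walk_max n x"
proof (induction n)
  case (Suc n)
  show ?case
  proof (cases "k = Suc n")
    case False
    then have "(\<Sum>i<k. x i) \<le> walk_max n x" using Suc by simp
    then show ?thesis by simp
  qed simp
qed simp

lemma walk_max_le: "(\<And>k. k \<le> n \<Longrightarrow> (\<Sum>i<k. x i) \<le> b) \<Longrightarrow> walk_max n x \<le> b"
proof (induction n)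
  case 0 from 0[of 0] show ?case by simp
next
  case (Suc n)
  have "walk_max n x \<le> b" by (rule Suc.IH) (simp add: Suc.prems)
  with Suc.prems[of "Suc n"] show ?case by simp
qed

lemma walk_max_cong: "(\<And>i. i < n \<Longrightarrow> x i = y i) \<Longrightarrow> walk_max n x = walk_max n y"
  by (induction n) (auto intro!: arg_cong2[where f=max] sum.cong)

lemma walk_max_measurable:
  "(\<And>i. i < n \<Longrightarrow> (\<lambda>\<omega>. Y i \<omega>) \<in> borel_measurable N) \<Longrightarrow>
    (\<lambda>\<omega>. walk_max n (\<lambda>i. Y i \<omega>)) \<in> borel_measurable N"
proof (induction n)
  case (Suc n)
  show ?case unfolding walk_max.simps
    by (intro borel_measurable_max Suc.IH borel_measurable_sum) (auto intro: Suc.prems)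
qed simp

text \<open>The defining recursion splits off the last step; splitting off the first step instead relates the
maximum to that of the shifted walk, which is what the cyclic argument below needs.\<close>

lemma walk_max_first_step:
  "walk_max (Suc n) x = max 0 (x 0 + walk_max n (\<lambda>i. x (Suc i)))"
proof (induction n)
  case (Suc n)
  have "walk_max (Suc (Suc n)) x = max (max 0 (x 0 + walk_max n (\<lambda>i. x (Suc i)))) (\<Sum>i<Suc (Suc n). x i)"
    by (simp only: walk_max.simps(2)[of "Suc n"] Suc)
  also have "(\<Sum>i<Suc (Suc n). x i) = x 0 + (\<Sum>i<Suc n. x (Suc i))"
    by (rule sum.lessThan_Suc_shift)
  finally show ?case by (simp add: max_def)
qed (simp add: max.commute)

text \<open>These bounds are what makes the comparison of a walk with its drifted version integrable, whatever
the law of the steps.\<close>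

lemma walk_max_drift:
  assumes "0 \<le> c"
  shows "walk_max n (\<lambda>i. x i - c) \<le> walk_max n x"
    and "walk_max n x \<le> walk_max n (\<lambda>i. x i - c) + real n * c"
proof -
  show "walk_max n (\<lambda>i. x i - c) \<le> walk_max n x"
  proof (rule walk_max_le)
    fix k assume "k \<le> n"
    have "(\<Sum>i<k. x i - c) \<le> (\<Sum>i<k. x i)" using assms by (intro sum_mono) simp
    also note partial_sum_le_walk_max[OF \<open>k \<le> n\<close>]
    finally show "(\<Sum>i<k. x i - c) \<le> walk_max n x" .
  qed
  show "walk_max n x \<le> walk_max n (\<lambda>i. x i - c) + real n * c"
  proof (rule walk_max_le)
    fix k assume "k \<le> n"
    have "(\<Sum>i<k. x i) = (\<Sum>i<k. x i - c) + real k * c"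
      by (simp add: sum_subtractf)
    also have "\<dots> \<le> walk_max n (\<lambda>i. x i - c) + real n * c"
      using assms \<open>k \<le> n\<close> by (intro add_mono partial_sum_le_walk_max mult_right_mono) auto
    finally show "(\<Sum>i<k. x i) \<le> walk_max n (\<lambda>i. x i - c) + real n * c" .
  qed
qed

lemma sum_mod_rotate:
  fixes x :: "nat \<Rightarrow> real"
  shows "(\<Sum>i<n. x ((i + j) mod n)) = (\<Sum>i<n. x i)"
proof (induction j)
  case (Suc j)
  show ?case
  proof (cases n)
    case (Suc m)
    have "(\<Sum>i<n. x ((i + Suc j) mod n)) = (\<Sum>i<m. x ((Suc i + j) mod n)) + x ((m + Suc j) mod n)"
      by (simp add: Suc)
    also have "(m + Suc j) mod n = (0 + j) mod n"
      using mod_add_self1[of n j] by (simp add: Suc)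
    also have "(\<Sum>i<m. x ((Suc i + j) mod n)) + x ((0 + j) mod n) = (\<Sum>i<n. x ((i + j) mod n))"
      unfolding Suc by (subst sum.lessThan_Suc_shift) simp
    finally show ?thesis using Suc.IH by simp
  qed simp
qed simp

text \<open>The combinatorial core of Spitzer's identity. All cyclic shifts of \<open>x\<close> have the same total \<open>s\<close>. If
\<open>s \<le> 0\<close>, the last partial sum never raises the maximum and both sides vanish. If \<open>s > 0\<close>, the
maximum over \<open>n\<close> steps is the first step plus the maximum over the remaining \<open>n - 1\<close> steps, which
are the first \<open>n - 1\<close> steps of the next cyclic shift; so the sum over the shifts telescopes, up to
the first steps, and these add up to \<open>s\<close>.\<close>

lemma cyclic_walk_max_increment:
  assumes "n > 0"
  shows "(\<Sum>j<n. walk_max n (\<lambda>i. x ((i + j) mod n)) - walk_max (n - 1) (\<lambda>i. x ((i + j) mod n)))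
          = max (\<Sum>i<n. x i) 0"
proof -
  obtain m where n: "n = Suc m" using assms by (cases n) auto
  \<comment> \<open>The \<open>j\<close>-th cyclic shift, extended periodically, so that dropping the first entry gives shift \<open>j + 1\<close>.\<close>
  define y where "y j = (\<lambda>i. x ((i + j) mod n))" for j
  define s where "s = (\<Sum>i<n. x i)"
  have sum_y: "(\<Sum>i<n. y j i) = s" for j
    by (simp add: y_def s_def sum_mod_rotate)
  show ?thesis
  proof (cases "s > 0")
    case True
    have step: "walk_max n (y j) - walk_max m (y j) = x j + walk_max m (y (Suc j)) - walk_max m (y j)"
      if "j < n" for j
    proof -
      have shift: "(\<lambda>i. y j (Suc i)) = y (Suc j)" by (simp add: y_def)
      have "s = y j 0 + (\<Sum>i<m. y j (Suc i))"
        using sum_y[of j] unfolding n by (subst (asm) sum.lessThan_Suc_shift) simp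
      also have "\<dots> \<le> y j 0 + walk_max m (y (Suc j))"
        using partial_sum_le_walk_max[of m m "y (Suc j)"] by (simp add: fun_cong[OF shift])
      finally have "walk_max n (y j) = y j 0 + walk_max m (y (Suc j))"
        using True unfolding n walk_max_first_step shift by simp
      then show ?thesis using that by (simp add: y_def)
    qed
    have "(\<Sum>j<n. walk_max n (y j) - walk_max m (y j))
        = (\<Sum>j<n. x j + (walk_max m (y (Suc j)) - walk_max m (y j)))"
      using step by (intro sum.cong) auto
    also have "\<dots> = s + (walk_max m (y n) - walk_max m (y 0))"
      using sum_lessThan_telescope[of "\<lambda>j. walk_max m (y j)" n]
      by (simp add: sum.distrib s_def)
    also have "y n = y 0" by (simp add: y_def)
    finally show ?thesis using True by (simp add: n y_def s_def)
  next
    case False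
    have "walk_max n (y j) = walk_max m (y j)" for j
      using sum_y[of j] False partial_sum_le_walk_max[of 0 m "y j"]
      unfolding n walk_max.simps by (simp add: max_def)
    then show ?thesis using False by (simp add: n y_def s_def max_def)
  qed
qed

text \<open>The law of an i.i.d. family is a power of one measure, hence invariant under permutations of the
coordinates. The congruence hypothesis says that \<open>G\<close> reads only the first \<open>n\<close> coordinates, so that it
does not matter how a vector is extended beyond them.\<close>

lemma (in prob_space) integral_iid_rotate:
  fixes \<xi> :: "nat \<Rightarrow> 'a \<Rightarrow> real" and G :: "(nat \<Rightarrow> real) \<Rightarrow> real"
  assumes indep: "indep_vars (\<lambda>_. borel) \<xi> {..<n}"
    and law: "\<And>i. i < n \<Longrightarrow> distr M borel (\<xi> i) = \<mu>"
    and G: "G \<in> borel_measurable (\<Pi>\<^sub>M i\<in>{..<n}. borel)"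
    and G_cong: "\<And>x y. (\<And>i. i < n \<Longrightarrow> x i = y i) \<Longrightarrow> G x = G y"
    and "n > 0"
  shows "(\<integral>\<omega>. G (\<lambda>i. \<xi> ((i + j) mod n) \<omega>) \<partial>M) = (\<integral>\<omega>. G (\<lambda>i. \<xi> i \<omega>) \<partial>M)"
proof -
  let ?I = "{..<n}"
  let ?P = "\<Pi>\<^sub>M i\<in>?I. (borel :: real measure)"
  let ?r = "\<lambda>i. (i + j) mod n"
  let ?\<Xi> = "\<lambda>\<omega>. \<lambda>i\<in>?I. \<xi> i \<omega>"
  have rv: "\<And>i. i \<in> ?I \<Longrightarrow> random_variable borel (\<xi> i)"
    using indep by (auto simp: indep_vars_def)
  have \<mu>_sets[measurable_cong]: "sets \<mu> = sets borel"
    using law[OF \<open>n > 0\<close>] by auto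
  have \<mu>_prob: "prob_space \<mu>"
    using law[OF \<open>n > 0\<close>] rv \<open>n > 0\<close> by (metis lessThan_iff prob_space_distr)
  have \<Xi>_meas: "?\<Xi> \<in> measurable M ?P" "(\<lambda>\<omega>. \<lambda>i\<in>?I. \<xi> (?r i) \<omega>) \<in> measurable M ?P"
    using rv \<open>n > 0\<close> by (auto intro!: measurable_restrict)
  have joint: "distr M ?P ?\<Xi> = (\<Pi>\<^sub>M i\<in>?I. \<mu>)"
  proof -
    have "distr M ?P ?\<Xi> = (\<Pi>\<^sub>M i\<in>?I. distr M borel (\<xi> i))"
      using indep indep_vars_iff_distr_eq_PiM'[where I="?I" and M'="\<lambda>_. borel" and X=\<xi>] rv \<open>n > 0\<close> by auto
    also have "\<dots> = (\<Pi>\<^sub>M i\<in>?I. \<mu>)" by (intro PiM_cong) (auto simp: law)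
    finally show ?thesis .
  qed
  have "inj_on ?r ?I"
  proof (rule inj_onI)
    fix a b assume "a \<in> ?I" "b \<in> ?I" "?r a = ?r b"
    then have "[a + j = b + j] (mod n)" by (simp add: cong_def)
    then have "[a = b] (mod n)" by (simp only: cong_add_rcancel_nat)
    then show "a = b" using \<open>a \<in> ?I\<close> \<open>b \<in> ?I\<close> by (simp add: cong_def)
  qed
  then have reindex: "distr (\<Pi>\<^sub>M i\<in>?I. \<mu>) (\<Pi>\<^sub>M i\<in>?I. \<mu>) (\<lambda>x. \<lambda>i\<in>?I. x (?r i)) = (\<Pi>\<^sub>M i\<in>?I. \<mu>)"
    using \<open>n > 0\<close> by (intro distr_PiM_reindex[of ?I "\<lambda>_. \<mu>" ?r ?I]) (auto intro: \<mu>_prob)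
  have sets_P: "sets (\<Pi>\<^sub>M i\<in>?I. \<mu>) = sets ?P" by (intro sets_PiM_cong) (auto simp: \<mu>_sets)
  have r_meas: "(\<lambda>x. \<lambda>i\<in>?I. x (?r i)) \<in> measurable ?P ?P"
    using \<open>n > 0\<close> by (auto intro!: measurable_restrict measurable_component_singleton)
  have "distr M ?P (\<lambda>\<omega>. \<lambda>i\<in>?I. \<xi> (?r i) \<omega>) = distr (distr M ?P ?\<Xi>) ?P (\<lambda>x. \<lambda>i\<in>?I. x (?r i))"
    using \<open>n > 0\<close> by (subst distr_distr[OF r_meas \<Xi>_meas(1)]) (auto intro!: distr_cong simp: fun_eq_iff)
  also have "\<dots> = distr (\<Pi>\<^sub>M i\<in>?I. \<mu>) (\<Pi>\<^sub>M i\<in>?I. \<mu>) (\<lambda>x. \<lambda>i\<in>?I. x (?r i))"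
    unfolding joint by (intro distr_cong) (auto simp: sets_P)
  also have "\<dots> = distr M ?P ?\<Xi>" unfolding reindex joint ..
  finally have eq: "distr M ?P (\<lambda>\<omega>. \<lambda>i\<in>?I. \<xi> (?r i) \<omega>) = distr M ?P ?\<Xi>" .
  have "(\<integral>\<omega>. G (\<lambda>i. \<xi> (?r i) \<omega>) \<partial>M) = (\<integral>\<omega>. G (\<lambda>i\<in>?I. \<xi> (?r i) \<omega>) \<partial>M)"
    by (intro Bochner_Integration.integral_cong refl G_cong) simp
  also have "\<dots> = (\<integral>x. G x \<partial>distr M ?P (\<lambda>\<omega>. \<lambda>i\<in>?I. \<xi> (?r i) \<omega>))"
    by (rule integral_distr[symmetric, OF \<Xi>_meas(2) G])
  also have "\<dots> = (\<integral>\<omega>. G (?\<Xi> \<omega>) \<partial>M)"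
    unfolding eq by (rule integral_distr[OF \<Xi>_meas(1) G])
  also have "\<dots> = (\<integral>\<omega>. G (\<lambda>i. \<xi> i \<omega>) \<partial>M)"
    by (intro Bochner_Integration.integral_cong refl G_cong) simp
  finally show ?thesis .
qed

text \<open>Averaging the cyclic identity over the i.i.d. steps. Spitzer's identity itself would need integrable
steps; its difference for the steps \<open>\<xi> i\<close> and \<open>\<xi> i - c\<close> involves only bounded variables and
so holds for every law.\<close>

lemma (in prob_space) spitzer_increment:
  fixes \<xi> :: "nat \<Rightarrow> 'a \<Rightarrow> real"
  assumes indep: "indep_vars (\<lambda>_. borel) \<xi> {..<n}"
    and law: "\<And>i. i < n \<Longrightarrow> distr M borel (\<xi> i) = \<mu>"
    and "n > 0" "0 \<le> c"
  shows "(\<integral>\<omega>. (walk_max n (\<lambda>i. \<xi> i \<omega>) - walk_max n (\<lambda>i. \<xi> i \<omega> - c))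
             - (walk_max (n - 1) (\<lambda>i. \<xi> i \<omega>) - walk_max (n - 1) (\<lambda>i. \<xi> i \<omega> - c)) \<partial>M)
       = (\<integral>\<omega>. max (\<Sum>i<n. \<xi> i \<omega>) 0 - max ((\<Sum>i<n. \<xi> i \<omega>) - real n * c) 0 \<partial>M) / real n"
proof -
  define D where "D k x = walk_max k x - walk_max k (\<lambda>i. x i - c)" for k and x :: "nat \<Rightarrow> real"
  define G where "G x = D n x - D (n - 1) x" for x
  let ?r = "\<lambda>j i. (i + j) mod n"
  have rv: "\<And>i. i < n \<Longrightarrow> random_variable borel (\<xi> i)"
    using indep by (auto simp: indep_vars_def)
  have D_meas: "(\<lambda>\<omega>. D k (\<lambda>i. Y i \<omega>)) \<in> borel_measurable N"
    if "\<And>i. i < k \<Longrightarrow> Y i \<in> borel_measurable N" for k N and Y :: "nat \<Rightarrow> 'c \<Rightarrow> real"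
    unfolding D_def by (intro borel_measurable_diff walk_max_measurable that borel_measurable_const)
  have D_cong: "D k x = D k y" if "\<And>i. i < k \<Longrightarrow> x i = y i" for k x y
    unfolding D_def using that by (intro arg_cong2[where f="(-)"] walk_max_cong) auto
  have D_bound: "\<bar>D k x\<bar> \<le> real k * c" for k x
    using walk_max_drift[OF \<open>0 \<le> c\<close>, of k x] unfolding D_def by simp
  have int_D: "integrable M (\<lambda>\<omega>. D k (\<lambda>i. \<xi> (?r j i) \<omega>))" if "k \<le> n" for k j
    using D_bound \<open>n > 0\<close>
    by (intro integrable_const_bound[where B="real k * c"] D_meas rv) auto
  have G_meas: "G \<in> borel_measurable (\<Pi>\<^sub>M i\<in>{..<n}. borel)"
    unfolding G_def
    by (intro borel_measurable_diff D_meas measurable_component_singleton) auto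
  have G_cong: "G x = G y" if "\<And>i. i < n \<Longrightarrow> x i = y i" for x y
    unfolding G_def using that by (intro arg_cong2[where f="(-)"] D_cong) auto
  have path: "(\<Sum>j<n. G (\<lambda>i. x (?r j i))) = max (\<Sum>i<n. x i) 0 - max ((\<Sum>i<n. x i) - real n * c) 0" for x
    using cyclic_walk_max_increment[OF \<open>n > 0\<close>, of x]
      cyclic_walk_max_increment[OF \<open>n > 0\<close>, of "\<lambda>i. x i - c"]
    by (simp add: G_def D_def sum_subtractf sum.distrib algebra_simps)
  have "real n * (\<integral>\<omega>. G (\<lambda>i. \<xi> i \<omega>) \<partial>M) = (\<Sum>j<n. \<integral>\<omega>. G (\<lambda>i. \<xi> (?r j i) \<omega>) \<partial>M)"
    using integral_iid_rotate[OF indep law G_meas G_cong \<open>n > 0\<close>] by simp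
  also have "\<dots> = (\<integral>\<omega>. (\<Sum>j<n. G (\<lambda>i. \<xi> (?r j i) \<omega>)) \<partial>M)"
    unfolding G_def
    by (intro Bochner_Integration.integral_sum[symmetric] Bochner_Integration.integrable_diff int_D) auto
  also have "\<dots> = (\<integral>\<omega>. max (\<Sum>i<n. \<xi> i \<omega>) 0 - max ((\<Sum>i<n. \<xi> i \<omega>) - real n * c) 0 \<partial>M)"
    using path[of "\<lambda>i. \<xi> i _"] by simp
  finally show ?thesis
    using \<open>n > 0\<close> unfolding G_def D_def by (simp add: field_simps)
qed

lemma (in prob_space) spitzer_drift_difference:
  fixes \<xi> :: "nat \<Rightarrow> 'a \<Rightarrow> real"
  assumes indep: "indep_vars (\<lambda>_. borel) \<xi> {..<n}"
    and law: "\<And>i. i < n \<Longrightarrow> distr M borel (\<xi> i) = \<mu>"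
    and "0 \<le> c"
  shows "(\<integral>\<omega>. walk_max n (\<lambda>i. \<xi> i \<omega>) - walk_max n (\<lambda>i. \<xi> i \<omega> - c) \<partial>M)
       = (\<Sum>k=1..n. (\<integral>\<omega>. max (\<Sum>i<k. \<xi> i \<omega>) 0 - max ((\<Sum>i<k. \<xi> i \<omega>) - real k * c) 0 \<partial>M) / real k)"
  using indep law
proof (induction n)
  case (Suc n)
  let ?D = "\<lambda>k \<omega>. walk_max k (\<lambda>i. \<xi> i \<omega>) - walk_max k (\<lambda>i. \<xi> i \<omega> - c)"
  have rv: "\<And>i. i < Suc n \<Longrightarrow> random_variable borel (\<xi> i)"
    using Suc.prems(1) by (auto simp: indep_vars_def)
  have int_D: "integrable M (?D k)" if "k \<le> Suc n" for k
  proof (rule integrable_const_bound[where B="real k * c"])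
    show "?D k \<in> borel_measurable M"
      using that by (intro borel_measurable_diff walk_max_measurable rv borel_measurable_const) auto
    show "AE \<omega> in M. norm (?D k \<omega>) \<le> real k * c"
      using walk_max_drift[OF \<open>0 \<le> c\<close>, of k] by (simp add: diff_le_eq add.commute)
  qed
  have "(\<integral>\<omega>. ?D (Suc n) \<omega> \<partial>M) = (\<integral>\<omega>. ?D n \<omega> \<partial>M) + (\<integral>\<omega>. ?D (Suc n) \<omega> - ?D n \<omega> \<partial>M)"
    by (subst Bochner_Integration.integral_diff[OF int_D int_D]) auto
  also have "(\<integral>\<omega>. ?D n \<omega> \<partial>M)
     = (\<Sum>k=1..n. (\<integral>\<omega>. max (\<Sum>i<k. \<xi> i \<omega>) 0 - max ((\<Sum>i<k. \<xi> i \<omega>) - real k * c) 0 \<partial>M) / real k)"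
    using Suc.prems by (intro Suc.IH) (auto intro: indep_vars_subset)
  also have "(\<integral>\<omega>. ?D (Suc n) \<omega> - ?D n \<omega> \<partial>M)
     = (\<integral>\<omega>. max (\<Sum>i<Suc n. \<xi> i \<omega>) 0 - max ((\<Sum>i<Suc n. \<xi> i \<omega>) - real (Suc n) * c) 0 \<partial>M) / real (Suc n)"
    using spitzer_increment[OF Suc.prems _ \<open>0 \<le> c\<close>] by simp
  finally show ?case by simp
qed simp

section \<open>Approximation on a grid from the right\<close>

lemma tendsto_from_right:
  fixes f :: "real \<Rightarrow> real" and g :: "nat \<Rightarrow> real"
  assumes f: "(f \<longlongrightarrow> f s) (at_right s)" and g: "g \<longlonglongrightarrow> s" and ge: "\<And>m. s \<le> g m"
  shows "(\<lambda>m. f (g m)) \<longlonglongrightarrow> f s"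
proof (rule topological_tendstoI)
  fix S assume S: "open S" "f s \<in> S"
  from topological_tendstoD[OF f S] obtain b where b: "b > s" "\<And>y. s < y \<Longrightarrow> y < b \<Longrightarrow> f y \<in> S"
    by (auto simp: eventually_at_right_field)
  have "eventually (\<lambda>m. g m < b) sequentially"
    using order_tendstoD(2)[OF g \<open>b > s\<close>] .
  then show "eventually (\<lambda>m. f (g m) \<in> S) sequentially"
  proof eventually_elim
    case (elim m)
    with b(2)[of "g m"] ge[of m] S(2) show ?case by (cases "g m = s") auto
  qed
qed

text \<open>For \<open>s \<ge> 0\<close>, the least multiple of \<open>h\<close> that is not below \<open>s\<close>. Approximating times from the right
is the direction in which cadlag paths are continuous.\<close>

definition grid_above :: "real \<Rightarrow> real \<Rightarrow> real" where
  "grid_above h s = h * real (nat \<lceil>s / h\<rceil>)"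

lemma grid_above_bounds:
  assumes "h > 0" "0 \<le> s"
  shows "s \<le> grid_above h s" "grid_above h s < s + h"
proof -
  define N where "N = real (nat \<lceil>s / h\<rceil>)"
  have "0 \<le> s / h" using assms by simp
  then have "s / h \<le> N" "N < s / h + 1" unfolding N_def by linarith+
  then have "s \<le> h * N" "h * N < s + h"
    using assms by (simp_all add: field_simps)
  then show "s \<le> grid_above h s" "grid_above h s < s + h"
    unfolding grid_above_def N_def .
qed

lemma grid_index_le:
  assumes "0 \<le> s" "s \<le> t" "t > 0" "n > 0"
  shows "nat \<lceil>s / (t / real n)\<rceil> \<le> n"
proof -
  have "s / (t / real n) \<le> real n"
    using assms by (simp add: field_simps mult_right_mono)
  then have "\<lceil>s / (t / real n)\<rceil> \<le> int n" by (simp only: ceiling_le_iff of_int_of_nat_eq)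
  then show ?thesis by (simp only: nat_le_iff)
qed

lemma grid_above_le:
  assumes "0 \<le> s" "s \<le> t" "t > 0" "n > 0"
  shows "grid_above (t / real n) s \<le> t"
proof -
  have "t / real n * real (nat \<lceil>s / (t / real n)\<rceil>) \<le> t / real n * real n"
    using assms by (intro mult_left_mono of_nat_mono grid_index_le) auto
  then show ?thesis using assms by (simp add: grid_above_def)
qed

lemma grid_above_tendsto:
  assumes "0 \<le> s" "t > 0"
  shows "(\<lambda>m. grid_above (t / real (Suc m)) s) \<longlonglongrightarrow> s"
proof (rule tendsto_sandwich)
  show "eventually (\<lambda>m. s \<le> grid_above (t / real (Suc m)) s) sequentially"
    "eventually (\<lambda>m. grid_above (t / real (Suc m)) s \<le> s + t / real (Suc m)) sequentially"
    using assms
    by (auto intro!: always_eventually grid_above_bounds(1) less_imp_le[OF grid_above_bounds(2)] simp del: of_nat_Suc)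
  have "(\<lambda>m. t / real (Suc m)) \<longlonglongrightarrow> 0"
    using LIMSEQ_Suc[OF lim_const_over_n[of t]] by simp
  from tendsto_add[OF tendsto_const[of s] this]
  show "(\<lambda>m. s + t / real (Suc m)) \<longlonglongrightarrow> s" by simp
qed simp

text \<open>The right Riemann sum is the integral of \<open>q\<close> composed with \<^const>\<open>grid_above\<close>, and this
composition converges to \<open>q\<close> pointwise by right-continuity; dominated convergence does the
rest.\<close>

lemma right_riemann_sum_tendsto:
  fixes q :: "real \<Rightarrow> real"
  assumes "t > 0"
    and bound: "\<And>s. 0 < s \<Longrightarrow> s \<le> t \<Longrightarrow> \<bar>q s\<bar> \<le> B"
    and right_cont: "\<And>s. 0 < s \<Longrightarrow> s \<le> t \<Longrightarrow> (q \<longlongrightarrow> q s) (at_right s)"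
  shows "(\<lambda>s. indicator {0<..t} s * q s) \<in> borel_measurable borel"
    and "(\<lambda>m. \<Sum>k=1..Suc m. t / real (Suc m) * q (t / real (Suc m) * real k))
          \<longlonglongrightarrow> (\<integral>s. indicator {0<..t} s * q s \<partial>lborel)"
proof -
  define h where "h m = t / real (Suc m)" for m
  \<comment> \<open>The step function whose integral is the Riemann sum; it is written as a sum over the grid cells for the sake of measurability.\<close>
  define u where "u m s = (\<Sum>k=1..Suc m. q (h m * real k) * indicator {h m * (real k - 1)<..h m * real k} s)"
    for m and s :: real
  have h_pos: "h m > 0" for m using \<open>t > 0\<close> by (simp add: h_def)
  have u_eq: "u m s = indicator {0<..t} s * q (grid_above (h m) s)" for m s
  proof -
    let ?k = "nat \<lceil>s / h m\<rceil>"
    have cell: "s \<in> {h m * (real k - 1)<..h m * real k} \<longleftrightarrow> k = ?k" if "k \<in> {1..Suc m}" for k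
    proof -
      have "s \<in> {h m * (real k - 1)<..h m * real k} \<longleftrightarrow> real k - 1 < s / h m \<and> s / h m \<le> real k"
        using h_pos[of m] by (auto simp: field_simps)
      also have "\<dots> \<longleftrightarrow> \<lceil>s / h m\<rceil> = int k" by (auto simp: ceiling_eq_iff)
      also have "\<dots> \<longleftrightarrow> k = ?k" using that by auto
      finally show ?thesis .
    qed
    have range: "?k \<in> {1..Suc m} \<longleftrightarrow> s \<in> {0<..t}"
    proof -
      have "1 \<le> ?k \<longleftrightarrow> 0 < s / h m" by linarith
      moreover have "?k \<le> Suc m \<longleftrightarrow> s / h m \<le> real (Suc m)"
        by (simp add: nat_le_iff ceiling_le_iff del: of_nat_Suc)
      moreover have "h m * real (Suc m) = t" by (simp add: h_def)
      ultimately show ?thesis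
        using h_pos[of m] by (auto simp: zero_less_divide_iff pos_divide_le_eq mult.commute)
    qed
    have "u m s = (\<Sum>k\<in>{1..Suc m}. if k = ?k then q (h m * real k) else 0)"
      unfolding u_def using cell by (intro sum.cong refl) (simp add: indicator_def)
    also have "\<dots> = (if ?k \<in> {1..Suc m} then q (h m * real ?k) else 0)"
      by (rule sum.delta) simp
    also have "\<dots> = indicator {0<..t} s * q (grid_above (h m) s)"
      unfolding range grid_above_def by (simp add: indicator_def)
    finally show ?thesis .
  qed
  have u_lim: "(\<lambda>m. u m s) \<longlonglongrightarrow> indicator {0<..t} s * q s" for s
  proof (cases "s \<in> {0<..t}")
    case True
    have "(\<lambda>m. q (grid_above (h m) s)) \<longlonglongrightarrow> q s"
    proof (rule tendsto_from_right[where f=q])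
      show "(\<lambda>m. grid_above (h m) s) \<longlonglongrightarrow> s"
        unfolding h_def using True \<open>t > 0\<close> by (intro grid_above_tendsto) auto
    qed (use True in \<open>auto intro: right_cont grid_above_bounds(1) h_pos\<close>)
    then show ?thesis using True by (simp add: u_eq)
  qed (simp add: u_eq)
  have u_meas: "u m \<in> borel_measurable borel" for m
    unfolding u_def by measurable
  show meas: "(\<lambda>s. indicator {0<..t} s * q s) \<in> borel_measurable borel"
    by (rule borel_measurable_LIMSEQ_real[OF u_lim u_meas])
  have u_int: "(\<integral>s. u m s \<partial>lborel) = (\<Sum>k=1..Suc m. h m * q (h m * real k))" for m
  proof -
    have "(\<integral>s. u m s \<partial>lborel)
        = (\<Sum>k=1..Suc m. \<integral>s. q (h m * real k) * indicator {h m * (real k - 1)<..h m * real k} s \<partial>lborel)"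
      unfolding u_def using h_pos[of m]
      by (intro Bochner_Integration.integral_sum integrable_mult_right)
         (auto simp: integrable_indicator_iff)
    also have "\<dots> = (\<Sum>k=1..Suc m. h m * q (h m * real k))"
      using h_pos[of m] by (intro sum.cong refl) (simp add: algebra_simps)
    finally show ?thesis .
  qed
  have "(\<lambda>m. \<integral>s. u m s \<partial>lborel) \<longlonglongrightarrow> (\<integral>s. indicator {0<..t} s * q s \<partial>lborel)"
  proof (rule integral_dominated_convergence[where w="\<lambda>s. B * indicator {0<..t} s"])
    show "(\<lambda>s. indicator {0<..t} s * q s) \<in> borel_measurable lborel" using meas by simp
    show "u m \<in> borel_measurable lborel" for m using u_meas by simp
    show "integrable lborel (\<lambda>s. B * indicator {0<..t} s)"
      using \<open>t > 0\<close> by (intro integrable_mult_right) (auto simp: integrable_indicator_iff)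
    show "AE s in lborel. norm (u m s) \<le> B * indicator {0<..t} s" for m
    proof (rule AE_I2)
      fix s
      show "norm (u m s) \<le> B * indicator {0<..t} s"
      proof (cases "s \<in> {0<..t}")
        case True
        then have "\<bar>q (grid_above (h m) s)\<bar> \<le> B"
          using grid_above_bounds(1)[of "h m" s] grid_above_le[of s t "Suc m"] h_pos[of m] \<open>t > 0\<close>
          unfolding h_def by (intro bound) auto
        then show ?thesis using True by (simp add: u_eq)
      qed (simp add: u_eq)
    qed
  qed (simp add: u_lim)
  then show "(\<lambda>m. \<Sum>k=1..Suc m. t / real (Suc m) * q (t / real (Suc m) * real k))
          \<longlonglongrightarrow> (\<integral>s. indicator {0<..t} s * q s \<partial>lborel)"
    unfolding u_int h_def .
qed

section \<open>Suprema of cadlag paths\<close>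

text \<open>Compactness of the interval. With \<open>Q = UNIV\<close> it bounds cadlag paths; with \<open>Q = {..<A}\<close> it shows that
a path that stays locally away from the level \<open>A\<close> does so uniformly, which yields the attainment of
the supremum.\<close>

lemma local_to_global_upper_bound:
  fixes f :: "real \<Rightarrow> real"
  assumes Q: "\<And>b b'. b \<in> Q \<Longrightarrow> b' \<in> Q \<Longrightarrow> max b b' \<in> Q" "Q \<noteq> {}"
    and loc: "\<And>s. s \<in> {0..t} \<Longrightarrow> \<exists>b\<in>Q. eventually (\<lambda>r. r \<in> {0..t} \<longrightarrow> f r \<le> b) (nhds s)"
  shows "\<exists>b\<in>Q. \<forall>r\<in>{0..t}. f r \<le> b"
proof -
  from loc have "\<forall>s\<in>{0..t}. \<exists>U b. open U \<and> s \<in> U \<and> b \<in> Q \<and> (\<forall>r\<in>U. r \<in> {0..t} \<longrightarrow> f r \<le> b)"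
    unfolding eventually_nhds by meson
  then obtain U b where U: "\<And>s. s \<in> {0..t} \<Longrightarrow> open (U s)" "\<And>s. s \<in> {0..t} \<Longrightarrow> s \<in> U s"
    and b: "\<And>s. s \<in> {0..t} \<Longrightarrow> b s \<in> Q"
    and fb: "\<And>s r. s \<in> {0..t} \<Longrightarrow> r \<in> U s \<Longrightarrow> r \<in> {0..t} \<Longrightarrow> f r \<le> b s"
    by metis
  obtain C where C: "C \<subseteq> {0..t}" "finite C" "{0..t} \<subseteq> (\<Union>s\<in>C. U s)"
    using compactE_image[of "{0..t}" "{0..t}" U] U by (metis UN_I compact_Icc subsetI)
  have "\<exists>B\<in>Q. \<forall>s\<in>C. b s \<le> B" using C(2,1)
  proof (induction C rule: finite_induct)
    case empty then show ?case using Q(2) by auto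
  next
    case (insert s C)
    then obtain B where "B \<in> Q" "\<forall>s\<in>C. b s \<le> B" by auto
    moreover have "b s \<in> Q" using insert.prems b by auto
    ultimately show ?case using Q(1) by (intro bexI[of _ "max (b s) B"]) (auto simp: le_max_iff_disj)
  qed
  then obtain B where B: "B \<in> Q" "\<And>s. s \<in> C \<Longrightarrow> b s \<le> B" by auto
  have "f r \<le> B" if r: "r \<in> {0..t}" for r
  proof -
    obtain s where "s \<in> C" "r \<in> U s" using C(3) r by blast
    then show ?thesis using fb[of s r] C(1) r B(2)[of s] by auto
  qed
  with B(1) show ?thesis by blast
qed

lemma cadlag_left_limit:
  assumes "cadlag f" "0 < s"
  shows "(f \<longlongrightarrow> left_limit f s) (at_left s)"
proof -
  obtain l where "(f \<longlongrightarrow> l) (at_left s)" using assms unfolding cadlag_def by blast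
  moreover from this have "Lim (at_left s) f = l" by (intro tendsto_Lim) auto
  ultimately show ?thesis using assms by (simp add: left_limit_def)
qed

lemma cadlag_locally_below:
  assumes f: "cadlag f" and s: "s \<in> {0..t}" and b: "max (f s) (left_limit f s) < b"
  shows "eventually (\<lambda>r. r \<in> {0..t} \<longrightarrow> f r \<le> b) (nhds s)"
proof -
  have "(f \<longlongrightarrow> f s) (at_right s)" using f s by (simp add: cadlag_def)
  from order_tendstoD(2)[OF this, of b] b
  have right: "eventually (\<lambda>r. r \<in> {0..t} \<longrightarrow> f r \<le> b) (at_right s)"
    by (auto elim: eventually_mono)
  have left: "eventually (\<lambda>r. r \<in> {0..t} \<longrightarrow> f r \<le> b) (at_left s)"
  proof (cases "s > 0")
    case True
    from order_tendstoD(2)[OF cadlag_left_limit[OF f True], of b] b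
    show ?thesis by (auto elim: eventually_mono)
  next
    case False
    have "eventually (\<lambda>r. r < s) (at_left s)" by (simp add: eventually_at_filter)
    then show ?thesis by eventually_elim (use False s in auto)
  qed
  from left right b show ?thesis
    by (auto simp: eventually_nhds_conv_at eventually_at_split)
qed

lemma cadlag_bdd_above:
  assumes "cadlag f"
  shows "bdd_above (f ` {0..t})"
proof -
  have "\<exists>b\<in>UNIV. \<forall>r\<in>{0..t}. f r \<le> b"
  proof (rule local_to_global_upper_bound)
    fix s assume "s \<in> {0..t}"
    from cadlag_locally_below[OF assms this, of "max (f s) (left_limit f s) + 1"]
    show "\<exists>b\<in>UNIV. eventually (\<lambda>r. r \<in> {0..t} \<longrightarrow> f r \<le> b) (nhds s)" by auto
  qed auto
  then obtain b where "\<And>r. r \<in> {0..t} \<Longrightarrow> f r \<le> b" by blast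
  then show ?thesis by (rule bdd_aboveI2)
qed

lemma left_limit_le:
  assumes f: "cadlag f" and s: "s \<in> {0..t}" and le: "\<And>r. r \<in> {0..t} \<Longrightarrow> f r \<le> b"
  shows "left_limit f s \<le> b"
proof (cases "s > 0")
  case True
  have "eventually (\<lambda>r. r \<in> {0<..<s}) (at_left s)"
    by (rule eventually_at_leftI[OF _ True]) auto
  then have "eventually (\<lambda>r. f r \<le> b) (at_left s)"
    by eventually_elim (rule le, use s in auto)
  then show ?thesis
    by (intro tendsto_upperbound[OF cadlag_left_limit[OF f True]]) auto
qed (use s le in \<open>auto simp: left_limit_def\<close>)

text \<open>If neither the value nor the left limit reached the supremum at any time, the path would be locally,
and hence globally, bounded by something smaller. This is also why the set in
\<^const>\<open>time_of_sup\<close> is nonempty.\<close>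

lemma cadlag_attains_sup:
  assumes f: "cadlag f" and "0 \<le> t"
  shows "\<exists>s\<in>{0..t}. max (f s) (left_limit f s) = (SUP r\<in>{0..t}. f r)"
proof (rule ccontr)
  let ?A = "SUP r\<in>{0..t}. f r"
  assume neg: "\<not> ?thesis"
  have le: "f r \<le> ?A" if "r \<in> {0..t}" for r
    by (rule cSUP_upper[OF that cadlag_bdd_above[OF f]])
  have "\<exists>b\<in>{..<?A}. \<forall>r\<in>{0..t}. f r \<le> b"
  proof (rule local_to_global_upper_bound)
    fix s assume s: "s \<in> {0..t}"
    have "max (f s) (left_limit f s) < ?A"
      using neg le[OF s] left_limit_le[OF f s le] s by (simp add: order_less_le)
    then obtain b where "max (f s) (left_limit f s) < b" "b < ?A" using dense by blast
    with cadlag_locally_below[OF f s] 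
    show "\<exists>b\<in>{..<?A}. eventually (\<lambda>r. r \<in> {0..t} \<longrightarrow> f r \<le> b) (nhds s)" by blast
  qed auto
  then obtain b where "b < ?A" "\<forall>r\<in>{0..t}. f r \<le> b" by auto
  moreover from this have "?A \<le> b" using \<open>0 \<le> t\<close> by (intro cSUP_least) auto
  ultimately show False by simp
qed

lemma cadlag_drift:
  assumes "cadlag f"
  shows "cadlag (\<lambda>s. f s - c * s)"
proof -
  have "((\<lambda>s. f s - c * s) \<longlongrightarrow> l - c * x) F"
    if "(f \<longlongrightarrow> l) F" "F \<le> at x" for l x :: real and F
    by (intro tendsto_intros that(1) tendsto_mono[OF that(2) tendsto_ident_at])
  from this[OF _ at_le[OF subset_UNIV]] show ?thesis
    using assms unfolding cadlag_def by blast
qed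

text \<open>The supremum as a function of a drift subtracted from the path. It is the link between the two
quantities of interest: its value at \<open>c = 0\<close> is the running supremum, and its right derivative there
is minus the first time of the supremum.\<close>

definition drifted_sup :: "(real \<Rightarrow> real) \<Rightarrow> real \<Rightarrow> real \<Rightarrow> real" where
  "drifted_sup f t c = (SUP s\<in>{0..t}. f s - c * s)"

lemma drifted_sup_upper:
  "cadlag f \<Longrightarrow> s \<in> {0..t} \<Longrightarrow> f s - c * s \<le> drifted_sup f t c"
  unfolding drifted_sup_def by (intro cSUP_upper cadlag_bdd_above cadlag_drift)

lemma drifted_sup_least:
  "0 \<le> t \<Longrightarrow> (\<And>s. s \<in> {0..t} \<Longrightarrow> f s - c * s \<le> b) \<Longrightarrow> drifted_sup f t c \<le> b"
  unfolding drifted_sup_def by (intro cSUP_least) auto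

lemma drifted_sup_antimono:
  assumes f: "cadlag f" and "0 \<le> t" "c \<le> c'"
  shows "drifted_sup f t c' \<le> drifted_sup f t c"
proof (rule drifted_sup_least[OF \<open>0 \<le> t\<close>])
  fix s assume s: "s \<in> {0..t}"
  then have "f s - c' * s \<le> f s - c * s" using \<open>c \<le> c'\<close> by (simp add: mult_right_mono)
  with drifted_sup_upper[OF f s, of c] show "f s - c' * s \<le> drifted_sup f t c" by simp
qed

text \<open>Values on the grid never exceed the supremum, and by right-continuity they come close to the value at
any given time.\<close>

lemma grid_max_tendsto_sup:
  assumes f: "cadlag f" and f0: "f 0 = 0" and "t > 0"
  shows "(\<lambda>m. walk_max (Suc m) (\<lambda>i. f (t / real (Suc m) * real (Suc i)) - f (t / real (Suc m) * real i)))
           \<longlonglongrightarrow> drifted_sup f t 0"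
proof -
  define h where "h m = t / real (Suc m)" for m
  define W where "W m = walk_max (Suc m) (\<lambda>i. f (h m * real (Suc i)) - f (h m * real i))" for m
  have h_pos: "h m > 0" for m using \<open>t > 0\<close> by (simp add: h_def)
  have partial: "(\<Sum>i<k. f (h m * real (Suc i)) - f (h m * real i)) = f (h m * real k)" for m k
    using sum_lessThan_telescope[of "\<lambda>i. f (h m * real i)" k] f0 by simp
  have W_le: "W m \<le> drifted_sup f t 0" for m
    unfolding W_def
  proof (rule walk_max_le, unfold partial)
    fix k assume "k \<le> Suc m"
    then have "h m * real k \<le> h m * real (Suc m)"
      using h_pos[of m] by (intro mult_left_mono) auto
    moreover have "h m * real (Suc m) = t" by (simp add: h_def)
    moreover have "0 \<le> h m * real k" using h_pos[of m] by simp
    ultimately have "h m * real k \<in> {0..t}" by simp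
    from drifted_sup_upper[OF f this, of 0] show "f (h m * real k) \<le> drifted_sup f t 0" by simp
  qed
  have W_ge: "f (grid_above (h m) s) \<le> W m" if "s \<in> {0..t}" for m s
  proof -
    have "nat \<lceil>s / h m\<rceil> \<le> Suc m"
      using grid_index_le[of s t "Suc m"] that \<open>t > 0\<close> by (simp add: h_def)
    from partial_sum_le_walk_max[OF this, of "\<lambda>i. f (h m * real (Suc i)) - f (h m * real i)"]
    show ?thesis unfolding W_def partial grid_above_def .
  qed
  have "W \<longlonglongrightarrow> drifted_sup f t 0"
  proof (rule order_tendstoI)
    fix a assume "a < drifted_sup f t 0"
    then obtain s where s: "s \<in> {0..t}" "a < f s"
      using drifted_sup_least[of t f 0 a] \<open>t > 0\<close> by (force simp: not_le[symmetric])
    have "(\<lambda>m. f (grid_above (h m) s)) \<longlonglongrightarrow> f s"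
    proof (rule tendsto_from_right[where f=f])
      show "(\<lambda>m. grid_above (h m) s) \<longlonglongrightarrow> s"
        unfolding h_def using s(1) \<open>t > 0\<close> by (intro grid_above_tendsto) auto
    qed (use s(1) f in \<open>auto simp: cadlag_def intro: grid_above_bounds(1) h_pos\<close>)
    from order_tendstoD(1)[OF this s(2)]
    show "eventually (\<lambda>m. a < W m) sequentially"
      by eventually_elim (use W_ge[OF s(1)] in \<open>meson less_le_trans\<close>)
  next
    fix a assume "drifted_sup f t 0 < a"
    then show "eventually (\<lambda>m. W m < a) sequentially"
      using W_le by (auto intro!: always_eventually intro: le_less_trans)
  qed
  then show ?thesis unfolding W_def h_def .
qed

lemma drifted_sup_drift: "drifted_sup (\<lambda>s. f s - c * s) t 0 = drifted_sup f t c"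
  by (simp add: drifted_sup_def)

text \<open>A large drift pushes the path below zero except near the origin, where the path is small by
right-continuity.\<close>

lemma drifted_sup_to_zero:
  assumes f: "cadlag f" and f0: "f 0 = 0" and "0 \<le> t"
  shows "(drifted_sup f t \<longlongrightarrow> 0) at_top"
proof (rule order_tendstoI)
  have nonneg: "0 \<le> drifted_sup f t c" for c
    using drifted_sup_upper[OF f, of 0 t c] f0 \<open>0 \<le> t\<close> by simp
  then show "eventually (\<lambda>c. a < drifted_sup f t c) at_top" if "a < 0" for a
    using that by (auto intro!: always_eventually intro: less_le_trans)
  fix a :: real assume "0 < a"
  have "(f \<longlongrightarrow> 0) (at_right 0)" using f f0 by (auto simp: cadlag_def)
  from order_tendstoD(2)[OF this, of "a/2"] \<open>0 < a\<close>
  obtain \<delta> where \<delta>: "\<delta> > 0" "\<And>s. 0 < s \<Longrightarrow> s < \<delta> \<Longrightarrow> f s < a / 2"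
    by (auto simp: eventually_at_right_field)
  let ?A = "drifted_sup f t 0"
  have "eventually (\<lambda>c. c \<ge> ?A / \<delta>) at_top" by (rule eventually_ge_at_top)
  then show "eventually (\<lambda>c. drifted_sup f t c < a) at_top"
  proof eventually_elim
    case (elim c)
    have "c \<ge> 0" using elim nonneg[of 0] \<delta>(1) by (meson divide_nonneg_pos order_trans)
    have "drifted_sup f t c \<le> a / 2"
    proof (rule drifted_sup_least[OF \<open>0 \<le> t\<close>])
      fix s assume s: "s \<in> {0..t}"
      consider "s = 0" | "0 < s" "s < \<delta>" | "\<delta> \<le> s" using s by force
      then show "f s - c * s \<le> a / 2"
      proof cases
        case 2
        moreover have "0 \<le> c * s" using \<open>c \<ge> 0\<close> 2 by simp
        ultimately show ?thesis using \<delta>(2)[of s] by simp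
      next
        case 3
        have "?A \<le> c * \<delta>" using elim \<delta>(1) by (simp add: field_simps)
        also have "\<dots> \<le> c * s" using 3 \<open>c \<ge> 0\<close> by (rule mult_left_mono)
        finally show ?thesis using drifted_sup_upper[OF f s, of 0] \<open>0 < a\<close> by simp
      qed (use f0 \<open>0 < a\<close> in simp)
    qed
    then show ?case using \<open>0 < a\<close> by simp
  qed
qed

text \<open>The envelope theorem for the family \<open>f s - c * s\<close>. Testing with a time \<open>s\<close> of the supremum shows
that a drift \<open>c\<close> lowers the supremum by at most \<open>c * s\<close>. Conversely, for \<open>u < \<tau>\<close> the supremum over
\<open>{0..u}\<close> is strictly smaller than that over \<open>{0..t}\<close>, because it is attained at some time before
\<open>\<tau>\<close>; thus for small \<open>c\<close> only times after \<open>u\<close> matter and the loss is at least \<open>c * u\<close>. The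
argument picks out the first time even if the supremum is reached several times.\<close>

lemma drifted_sup_slope:
  assumes f: "cadlag f" and "0 \<le> t"
  defines "\<tau> \<equiv> Inf {s \<in> {0..t}. max (f s) (left_limit f s) = (SUP s\<in>{0..t}. f s)}"
  shows "0 \<le> \<tau>" "\<tau> \<le> t"
    and "0 < c \<Longrightarrow> (drifted_sup f t 0 - drifted_sup f t c) / c \<le> \<tau>"
    and "((\<lambda>c. (drifted_sup f t 0 - drifted_sup f t c) / c) \<longlongrightarrow> \<tau>) (at_right 0)"
proof -
  let ?A = "drifted_sup f t 0"
  define S where "S = {s \<in> {0..t}. max (f s) (left_limit f s) = (SUP s\<in>{0..t}. f s)}"
  have A: "(SUP s\<in>{0..t}. f s) = ?A" by (simp add: drifted_sup_def)
  have \<tau>: "\<tau> = Inf S" by (simp add: \<tau>_def S_def)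
  have "S \<noteq> {}" using cadlag_attains_sup[OF f \<open>0 \<le> t\<close>] by (auto simp: S_def)
  then obtain s0 where s0: "s0 \<in> S" by auto
  have bdd: "bdd_below S" by (auto simp: S_def intro!: bdd_belowI[of _ 0])
  show "0 \<le> \<tau>" unfolding \<tau> using \<open>S \<noteq> {}\<close> by (intro cInf_greatest) (auto simp: S_def)
  show "\<tau> \<le> t" unfolding \<tau> using cInf_lower[OF s0 bdd] s0 by (simp add: S_def)
  have upper: "(?A - drifted_sup f t c) / c \<le> \<tau>" if "0 < c" for c
    unfolding \<tau>
  proof (rule cInf_greatest[OF \<open>S \<noteq> {}\<close>])
    fix s assume "s \<in> S"
    then have s: "s \<in> {0..t}" and att: "max (f s) (left_limit f s) = ?A" by (auto simp: S_def A)
    let ?g = "\<lambda>r. f r - c * r"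
    have g: "cadlag ?g" by (rule cadlag_drift[OF f])
    have le: "?g r \<le> drifted_sup f t c" if "r \<in> {0..t}" for r by (rule drifted_sup_upper[OF f that])
    have "left_limit f s - c * s = left_limit ?g s"
    proof (cases "s > 0")
      case True
      have "(?g \<longlongrightarrow> left_limit f s - c * s) (at_left s)"
        by (intro tendsto_intros cadlag_left_limit[OF f True])
      from tendsto_unique[OF _ this cadlag_left_limit[OF g True]] show ?thesis by simp
    qed (use s in \<open>auto simp: left_limit_def\<close>)
    with left_limit_le[OF g s le] le[OF s] att have "?A - c * s \<le> drifted_sup f t c"
      by (auto simp: max_def split: if_splits)
    then show "(?A - drifted_sup f t c) / c \<le> s" using \<open>0 < c\<close> by (simp add: field_simps)
  qed
  then show "0 < c \<Longrightarrow> (drifted_sup f t 0 - drifted_sup f t c) / c \<le> \<tau>" .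
  show "((\<lambda>c. (?A - drifted_sup f t c) / c) \<longlongrightarrow> \<tau>) (at_right 0)"
  proof (rule order_tendstoI)
    fix a assume "a < \<tau>"
    show "eventually (\<lambda>c. a < (?A - drifted_sup f t c) / c) (at_right 0)"
    proof (cases "a < 0")
      case True
      have "eventually (\<lambda>c::real. 0 < c) (at_right 0)" by (simp add: eventually_at_filter)
      then show ?thesis
      proof eventually_elim
        case (elim c)
        then have "0 \<le> (?A - drifted_sup f t c) / c"
          using drifted_sup_antimono[OF f \<open>0 \<le> t\<close>, of 0 c] by simp
        then show ?case using True by simp
      qed
    next
      case False
      obtain u where u: "a < u" "u < \<tau>" using dense[OF \<open>a < \<tau>\<close>] by auto
      then have u_range: "0 \<le> u" "u \<le> t" using False \<open>\<tau> \<le> t\<close> by auto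
      \<comment> \<open>Times up to \<open>u\<close> stay below the supremum by a fixed gap.\<close>
      let ?B = "SUP r\<in>{0..u}. f r"
      have B_le: "f r \<le> ?B" if "r \<in> {0..u}" for r
        by (rule cSUP_upper[OF that cadlag_bdd_above[OF f]])
      obtain s where s: "s \<in> {0..u}" "max (f s) (left_limit f s) = ?B"
        using cadlag_attains_sup[OF f u_range(1)] by auto
      have "s \<notin> S" using cInf_lower[OF _ bdd, of s] s(1) u(2) unfolding \<tau> by auto
      then have "?B \<noteq> ?A" using s u_range by (auto simp: S_def A)
      moreover have "?B \<le> ?A"
        using drifted_sup_upper[OF f, of _ t 0] u_range by (intro cSUP_least) auto
      ultimately have "?B < ?A" by simp
      \<comment> \<open>The \<open>+ 1\<close> only avoids a division by zero when \<open>u = 0\<close>.\<close>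
      then have pos: "(?A - ?B) / (u + 1) > 0" using u_range by simp
      have "eventually (\<lambda>c. c \<in> {0<..<(?A - ?B) / (u + 1)}) (at_right 0)"
        by (rule eventually_at_rightI[OF _ pos]) auto
      then show ?thesis
      proof eventually_elim
        case (elim c)
        then have c: "0 < c" "c * (u + 1) < ?A - ?B"
          using u_range by (auto simp: field_simps)
        have "drifted_sup f t c \<le> ?A - c * u"
        proof (rule drifted_sup_least[OF \<open>0 \<le> t\<close>])
          fix r assume r: "r \<in> {0..t}"
          show "f r - c * r \<le> ?A - c * u"
          proof (cases "r \<le> u")
            case True
            have "0 \<le> c * r" using c r by simp
            moreover have "c * u + c < ?A - ?B" using c(2) by (simp add: distrib_left)
            moreover have "f r \<le> ?B" using True r by (intro B_le) simp
            ultimately show ?thesis using c(1) by linarith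
          next
            case False
            then have "c * u \<le> c * r" using c by simp
            then show ?thesis using drifted_sup_upper[OF f r, of 0] by simp
          qed
        qed
        then have "u \<le> (?A - drifted_sup f t c) / c" using c by (simp add: field_simps)
        then show ?case using u(1) by simp
      qed
    qed
  next
    fix a assume "\<tau> < a"
    have "eventually (\<lambda>c::real. 0 < c) (at_right 0)" by (simp add: eventually_at_filter)
    then show "eventually (\<lambda>c. (?A - drifted_sup f t c) / c < a) (at_right 0)"
      by eventually_elim (use upper \<open>\<tau> < a\<close> in \<open>meson le_less_trans\<close>)
  qed
qed

section \<open>The drift comparison formula\<close>

lemma ramp_bounds:
  fixes x d :: real
  assumes "0 \<le> d"
  shows "0 \<le> max x 0 - max (x - d) 0" "max x 0 - max (x - d) 0 \<le> d"
  using assms by (auto simp: max_def)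

context levy_process
begin

definition sup_loss :: "real \<Rightarrow> real \<Rightarrow> 'a \<Rightarrow> real" where
  "sup_loss t c \<omega> = drifted_sup (\<lambda>s. X s \<omega>) t 0 - drifted_sup (\<lambda>s. X s \<omega>) t c"

text \<open>The integrand for the drift \<open>c\<close>: a bounded substitute for \<open>E max (X s) 0 / s\<close>, from which the
integrands of both formulae arise as limits in \<open>c\<close>.\<close>

definition ramp_rate :: "real \<Rightarrow> real \<Rightarrow> real" where
  "ramp_rate c s = (\<integral>\<omega>. (max (X s \<omega>) 0 - max (X s \<omega> - c * s) 0) / s \<partial>M)"

lemma ramp_quotient_bounds:
  assumes "0 \<le> c" "0 < s"
  shows "0 \<le> (max (X s \<omega>) 0 - max (X s \<omega> - c * s) 0) / s"
    and "(max (X s \<omega>) 0 - max (X s \<omega> - c * s) 0) / s \<le> c"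
  using ramp_bounds[of "c * s" "X s \<omega>"] assms by (auto simp: pos_divide_le_eq)

lemma ramp_quotient_integrable:
  assumes "0 \<le> c" "0 < s"
  shows "integrable M (\<lambda>\<omega>. (max (X s \<omega>) 0 - max (X s \<omega> - c * s) 0) / s)"
proof (rule integrable_const_bound[where B=c])
  show "AE \<omega> in M. norm ((max (X s \<omega>) 0 - max (X s \<omega> - c * s) 0) / s) \<le> c"
    using ramp_quotient_bounds[OF assms] by (intro AE_I2) (simp only: real_norm_def abs_of_nonneg)
  show "(\<lambda>\<omega>. (max (X s \<omega>) 0 - max (X s \<omega> - c * s) 0) / s) \<in> borel_measurable M"
    by (intro borel_measurable_divide borel_measurable_diff borel_measurable_max
        borel_measurable_const random_variable less_imp_le[OF \<open>0 < s\<close>])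
qed

lemma ramp_rate_bounds:
  assumes "0 \<le> c" "0 < s"
  shows "0 \<le> ramp_rate c s" "ramp_rate c s \<le> c"
proof -
  show "0 \<le> ramp_rate c s"
    unfolding ramp_rate_def by (intro integral_nonneg_AE AE_I2 ramp_quotient_bounds[OF assms])
  have "ramp_rate c s \<le> (\<integral>\<omega>. c \<partial>M)"
    unfolding ramp_rate_def
    by (intro integral_mono ramp_quotient_integrable ramp_quotient_bounds assms) simp
  then show "ramp_rate c s \<le> c" by (simp add: prob_space)
qed

text \<open>The paths are right-continuous, and dividing by \<open>s\<close> inside the expectation leaves variables with
values in \<open>{0..c}\<close>, so that dominated convergence applies.\<close>

lemma ramp_rate_right_continuous:
  assumes "0 \<le> c" "0 < s"
  shows "(ramp_rate c \<longlongrightarrow> ramp_rate c s) (at_right s)"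
proof (unfold tendsto_at_iff_sequentially, intro allI impI)
  fix r :: "nat \<Rightarrow> real"
  assume r: "\<forall>i. r i \<in> {s<..} - {s}" and lim: "r \<longlonglongrightarrow> s"
  have pos: "0 < r i" for i using r \<open>0 < s\<close> by (meson DiffD1 greaterThan_iff less_trans)
  have "(\<lambda>i. ramp_rate c (r i)) \<longlonglongrightarrow> ramp_rate c s"
    unfolding ramp_rate_def
  proof (rule integral_dominated_convergence[where w="\<lambda>_. c"])
    show "AE \<omega> in M. (\<lambda>i. (max (X (r i) \<omega>) 0 - max (X (r i) \<omega> - c * r i) 0) / r i)
            \<longlonglongrightarrow> (max (X s \<omega>) 0 - max (X s \<omega> - c * s) 0) / s"
    proof (rule AE_I2)
      fix \<omega> assume "\<omega> \<in> space M"
      then have "((\<lambda>t. X t \<omega>) \<longlongrightarrow> X s \<omega>) (at_right s)"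
        using cadlag_paths[of \<omega>] \<open>0 < s\<close> by (auto simp: cadlag_def)
      from tendsto_from_right[OF this lim] r
      have "(\<lambda>i. X (r i) \<omega>) \<longlonglongrightarrow> X s \<omega>" by (auto intro: less_imp_le)
      then show "(\<lambda>i. (max (X (r i) \<omega>) 0 - max (X (r i) \<omega> - c * r i) 0) / r i)
            \<longlonglongrightarrow> (max (X s \<omega>) 0 - max (X s \<omega> - c * s) 0) / s"
        using lim \<open>0 < s\<close> by (intro tendsto_intros) auto
    qed
    show "AE \<omega> in M. norm ((max (X (r i) \<omega>) 0 - max (X (r i) \<omega> - c * r i) 0) / r i) \<le> c" for i
      using ramp_quotient_bounds[OF \<open>0 \<le> c\<close> pos[of i]] by (intro AE_I2) (simp only: real_norm_def abs_of_nonneg)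
  qed (use ramp_quotient_integrable[OF \<open>0 \<le> c\<close>] pos \<open>0 < s\<close> in \<open>auto intro: borel_measurable_integrable\<close>)
  then show "(ramp_rate c \<circ> r) \<longlonglongrightarrow> ramp_rate c s" by (simp add: o_def)
qed

text \<open>On a grid of mesh \<open>h\<close> a Levy process is a random walk with i.i.d. steps, and the drift \<open>c\<close> lowers each
step by \<open>c * h\<close>. The weights \<open>1 / k\<close> in Spitzer's identity turn into \<open>h / s\<close> at the grid
point \<open>s = h * k\<close>, which makes the right-hand side a Riemann sum.\<close>

lemma grid_identity:
  fixes n :: nat
  assumes "0 < h" "0 \<le> c"
  shows "(\<integral>\<omega>. walk_max n (\<lambda>i. X (h * real (Suc i)) \<omega> - X (h * real i) \<omega>)
             - walk_max n (\<lambda>i. X (h * real (Suc i)) \<omega> - X (h * real i) \<omega> - c * h) \<partial>M)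
       = (\<Sum>k=1..n. h * ramp_rate c (h * real k))"
proof -
  define \<xi> where "\<xi> i \<omega> = X (h * real (Suc i)) \<omega> - X (h * real i) \<omega>" for i \<omega>
  have indep: "indep_vars (\<lambda>_. borel) \<xi> {..<n}"
    unfolding \<xi>_def using \<open>0 < h\<close>
    by (intro independent_increments[where u="\<lambda>i. h * real i"]) auto
  have law: "distr M borel (\<xi> i) = distr M borel (\<lambda>\<omega>. X h \<omega> - X 0 \<omega>)" for i
    using stationary_increments[of "h * real i" h] \<open>0 < h\<close>
    unfolding \<xi>_def by (simp add: algebra_simps)
  have partial: "(\<Sum>i<k. \<xi> i \<omega>) = X (h * real k) \<omega>" if "\<omega> \<in> space M" for k \<omega>
    using sum_lessThan_telescope[of "\<lambda>i. X (h * real i) \<omega>" k] start_zero[OF that]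
    by (simp add: \<xi>_def)
  have "(\<integral>\<omega>. walk_max n (\<lambda>i. \<xi> i \<omega>) - walk_max n (\<lambda>i. \<xi> i \<omega> - c * h) \<partial>M)
      = (\<Sum>k=1..n. (\<integral>\<omega>. max (\<Sum>i<k. \<xi> i \<omega>) 0 - max ((\<Sum>i<k. \<xi> i \<omega>) - real k * (c * h)) 0 \<partial>M) / real k)"
    using assms by (intro spitzer_drift_difference[OF indep law]) auto
  also have "\<dots> = (\<Sum>k=1..n. h * ramp_rate c (h * real k))"
  proof (rule sum.cong[OF refl])
    fix k assume "k \<in> {1..n}"
    then have "k > 0" by simp
    have "(\<integral>\<omega>. max (\<Sum>i<k. \<xi> i \<omega>) 0 - max ((\<Sum>i<k. \<xi> i \<omega>) - real k * (c * h)) 0 \<partial>M)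
       = (\<integral>\<omega>. max (X (h * real k) \<omega>) 0 - max (X (h * real k) \<omega> - c * (h * real k)) 0 \<partial>M)"
      by (intro Bochner_Integration.integral_cong refl) (simp add: partial mult.commute mult.left_commute)
    then show "(\<integral>\<omega>. max (\<Sum>i<k. \<xi> i \<omega>) 0 - max ((\<Sum>i<k. \<xi> i \<omega>) - real k * (c * h)) 0 \<partial>M) / real k
        = h * ramp_rate c (h * real k)"
      using \<open>k > 0\<close> \<open>0 < h\<close> by (simp add: ramp_rate_def)
  qed
  finally show ?thesis unfolding \<xi>_def .
qed

lemma sup_loss_bounds:
  assumes \<omega>: "\<omega> \<in> space M" and "0 \<le> t" "0 \<le> c"
  shows "0 \<le> sup_loss t c \<omega>" "sup_loss t c \<omega> \<le> c * t"
proof -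
  show "0 \<le> sup_loss t c \<omega>"
    unfolding sup_loss_def using drifted_sup_antimono[OF cadlag_paths[OF \<omega>] assms(2,3)] by simp
  have "drifted_sup (\<lambda>s. X s \<omega>) t 0 \<le> drifted_sup (\<lambda>s. X s \<omega>) t c + c * t"
  proof (rule drifted_sup_least[OF \<open>0 \<le> t\<close>])
    fix s assume s: "s \<in> {0..t}"
    then have "c * s \<le> c * t" using \<open>0 \<le> c\<close> by (intro mult_left_mono) auto
    then show "X s \<omega> - 0 * s \<le> drifted_sup (\<lambda>s. X s \<omega>) t c + c * t"
      using drifted_sup_upper[OF cadlag_paths[OF \<omega>] s, of c] by simp
  qed
  then show "sup_loss t c \<omega> \<le> c * t" unfolding sup_loss_def by simp
qed

text \<open>The grid identity in the limit of vanishing mesh. Everything on the left is between \<open>0\<close> and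
\<open>c * t\<close>, everything under the integral on the right between \<open>0\<close> and \<open>c\<close>. Measurability comes from
the same limits.\<close>

lemma
  assumes "t > 0" "0 \<le> c"
  shows sup_loss_measurable: "sup_loss t c \<in> borel_measurable M"
    and expected_sup_loss:
      "(\<integral>\<omega>. sup_loss t c \<omega> \<partial>M) = (\<integral>s. indicator {0<..t} s * ramp_rate c s \<partial>lborel)"
    and ramp_rate_measurable:
      "(\<lambda>s. indicator {0<..t} s * ramp_rate c s) \<in> borel_measurable borel"
proof -
  define h where "h m = t / real (Suc m)" for m
  define L where "L m \<omega> = walk_max (Suc m) (\<lambda>i. X (h m * real (Suc i)) \<omega> - X (h m * real i) \<omega>)
             - walk_max (Suc m) (\<lambda>i. X (h m * real (Suc i)) \<omega> - X (h m * real i) \<omega> - c * h m)" for m \<omega>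
  have h_pos: "h m > 0" for m using \<open>t > 0\<close> by (simp add: h_def)
  have L_meas: "L m \<in> borel_measurable M" for m
    unfolding L_def using h_pos[of m]
    by (intro borel_measurable_diff walk_max_measurable borel_measurable_const random_variable) auto
  have L_lim: "(\<lambda>m. L m \<omega>) \<longlonglongrightarrow> sup_loss t c \<omega>" if \<omega>: "\<omega> \<in> space M" for \<omega>
  proof -
    let ?f = "\<lambda>s. X s \<omega>"
    have eq: "(\<lambda>i. X (h m * real (Suc i)) \<omega> - X (h m * real i) \<omega> - c * h m)
       = (\<lambda>i. (?f (h m * real (Suc i)) - c * (h m * real (Suc i))) - (?f (h m * real i) - c * (h m * real i)))" for m
      by (simp add: algebra_simps)
    show ?thesis
      unfolding L_def sup_loss_def eq unfolding h_def drifted_sup_drift[of ?f c, symmetric]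
      by (intro tendsto_diff grid_max_tendsto_sup cadlag_drift cadlag_paths \<omega> \<open>t > 0\<close>)
         (simp_all add: start_zero[OF \<omega>])
  qed
  show meas: "sup_loss t c \<in> borel_measurable M"
    by (rule borel_measurable_LIMSEQ_real[OF L_lim L_meas])
  have "(\<lambda>m. \<integral>\<omega>. L m \<omega> \<partial>M) \<longlonglongrightarrow> (\<integral>\<omega>. sup_loss t c \<omega> \<partial>M)"
  proof (rule integral_dominated_convergence[where w="\<lambda>_. c * t"])
    show "AE \<omega> in M. norm (L m \<omega>) \<le> c * t" for m
    proof (rule AE_I2)
      fix \<omega>
      have "0 \<le> c * h m" using \<open>0 \<le> c\<close> h_pos[of m] by simp
      from walk_max_drift[OF this, of "Suc m" "\<lambda>i. X (h m * real (Suc i)) \<omega> - X (h m * real i) \<omega>"]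
      have "0 \<le> L m \<omega>" "L m \<omega> \<le> real (Suc m) * (c * h m)"
        unfolding L_def by linarith+
      moreover have "real (Suc m) * (c * h m) = c * t" by (simp add: h_def)
      ultimately show "norm (L m \<omega>) \<le> c * t" by (simp only: real_norm_def abs_of_nonneg)
    qed
  qed (use meas L_meas L_lim in auto)
  moreover have "(\<integral>\<omega>. L m \<omega> \<partial>M) = (\<Sum>k=1..Suc m. t / real (Suc m) * ramp_rate c (t / real (Suc m) * real k))" for m
    unfolding L_def grid_identity[OF h_pos \<open>0 \<le> c\<close>] unfolding h_def ..
  moreover have bound: "\<bar>ramp_rate c s\<bar> \<le> c" if "0 < s" for s
    using ramp_rate_bounds[OF \<open>0 \<le> c\<close> that] by simp
  note riemann = right_riemann_sum_tendsto[OF \<open>t > 0\<close>, of "ramp_rate c" c,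
      OF bound ramp_rate_right_continuous[OF \<open>0 \<le> c\<close>]]
  ultimately show "(\<integral>\<omega>. sup_loss t c \<omega> \<partial>M) = (\<integral>s. indicator {0<..t} s * ramp_rate c s \<partial>lborel)"
    using riemann(2) by (intro LIMSEQ_unique) auto
  show "(\<lambda>s. indicator {0<..t} s * ramp_rate c s) \<in> borel_measurable borel"
    by (rule riemann(1))
qed

lemma running_sup_eq: "running_sup X t \<omega> = drifted_sup (\<lambda>s. X s \<omega>) t 0"
  by (simp add: running_sup_def drifted_sup_def)

section \<open>The two limits of the drift\<close>

text \<open>Divide the comparison formula by \<open>c\<close> and let \<open>c\<close> tend to \<open>0\<close>. On the left the quotient tends to the
first time of the supremum, staying below \<open>t\<close>; on the right the ramp
\<open>(max x 0 - max (x - c * s) 0) / (c * s)\<close> tends to the indicator of \<open>x > 0\<close>, staying below \<open>1\<close>.\<close>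

lemma expected_time_of_sup:
  assumes "t > 0"
  shows "(\<integral>\<^sup>+\<omega>. ennreal (time_of_sup X t \<omega>) \<partial>M) =
         (\<integral>\<^sup>+s\<in>{0<..t}. ennreal \<P>(\<omega> in M. X s \<omega> > 0) \<partial>lborel)"
proof -
  define c where "c m = 1 / real (Suc m)" for m
  have c_pos: "c m > 0" for m by (simp add: c_def)
  have c_right: "filterlim c (at_right 0) sequentially"
    unfolding filterlim_at c_def
    using LIMSEQ_Suc[OF lim_const_over_n[of "1::real"]] by simp
  define \<tau> where "\<tau> = time_of_sup X t"
  have \<tau>: "\<tau> \<omega> = Inf {s \<in> {0..t}. max (X s \<omega>) (left_limit (\<lambda>s. X s \<omega>) s) = (SUP s\<in>{0..t}. X s \<omega>)}" for \<omega>
    by (simp add: \<tau>_def time_of_sup_def running_sup_def)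
  note slope = drifted_sup_slope[OF cadlag_paths less_imp_le[OF \<open>t > 0\<close>], folded \<tau> sup_loss_def]
  have quot_meas: "(\<lambda>\<omega>. sup_loss t (c m) \<omega> / c m) \<in> borel_measurable M" for m
    using sup_loss_measurable[OF \<open>t > 0\<close>, of "c m"] c_pos[of m] by simp
  have quot_lim: "(\<lambda>m. sup_loss t (c m) \<omega> / c m) \<longlonglongrightarrow> \<tau> \<omega>" if "\<omega> \<in> space M" for \<omega>
    by (rule filterlim_compose[OF slope(4)[OF that] c_right])
  have \<tau>_meas: "\<tau> \<in> borel_measurable M"
    by (rule borel_measurable_LIMSEQ_real[OF quot_lim quot_meas])
  have lhs: "(\<lambda>m. \<integral>\<omega>. sup_loss t (c m) \<omega> / c m \<partial>M) \<longlonglongrightarrow> (\<integral>\<omega>. \<tau> \<omega> \<partial>M)"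
  proof (rule integral_dominated_convergence[where w="\<lambda>_. t"])
    show "AE \<omega> in M. norm (sup_loss t (c m) \<omega> / c m) \<le> t" for m
    proof (rule AE_I2)
      fix \<omega> assume \<omega>: "\<omega> \<in> space M"
      have "0 \<le> sup_loss t (c m) \<omega> / c m" "sup_loss t (c m) \<omega> / c m \<le> t"
        using sup_loss_bounds[OF \<omega> less_imp_le[OF \<open>t > 0\<close>], of "c m"] c_pos[of m]
        by (simp_all add: pos_divide_le_eq mult.commute)
      then show "norm (sup_loss t (c m) \<omega> / c m) \<le> t" by (simp only: real_norm_def abs_of_nonneg)
    qed
  qed (use quot_meas quot_lim \<tau>_meas in auto)
  define p where "p s = \<P>(\<omega> in M. X s \<omega> > 0)" for s
  have p_lim: "(\<lambda>m. ramp_rate (c m) s / c m) \<longlonglongrightarrow> p s" if "0 < s" for s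
  proof -
    note [measurable] = random_variable[OF less_imp_le[OF that]]
    have quot: "0 \<le> (max (X s \<omega>) 0 - max (X s \<omega> - c m * s) 0) / s / c m"
      "(max (X s \<omega>) 0 - max (X s \<omega> - c m * s) 0) / s / c m \<le> 1" for m \<omega>
      using ramp_quotient_bounds[OF less_imp_le[OF c_pos[of m]] that, of \<omega>] c_pos[of m]
      by (simp_all only: divide_nonneg_pos pos_divide_le_eq mult_1)
    have "(\<lambda>m. \<integral>\<omega>. (max (X s \<omega>) 0 - max (X s \<omega> - c m * s) 0) / s / c m \<partial>M)
            \<longlonglongrightarrow> (\<integral>\<omega>. indicator {\<omega> \<in> space M. X s \<omega> > 0} \<omega> \<partial>M)"
    proof (rule integral_dominated_convergence[where w="\<lambda>_. 1"])
      show "AE \<omega> in M. (\<lambda>m. (max (X s \<omega>) 0 - max (X s \<omega> - c m * s) 0) / s / c m)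
              \<longlonglongrightarrow> indicator {\<omega> \<in> space M. X s \<omega> > 0} \<omega>"
      proof (rule AE_I2)
        fix \<omega> assume \<omega>: "\<omega> \<in> space M"
        have "eventually (\<lambda>m. (max (X s \<omega>) 0 - max (X s \<omega> - c m * s) 0) / s / c m
                = indicator {\<omega> \<in> space M. X s \<omega> > 0} \<omega>) sequentially"
        proof (cases "X s \<omega> > 0")
          case True
          have "(\<lambda>m. c m * s) \<longlonglongrightarrow> 0 * s"
            using c_right by (intro tendsto_mult tendsto_const) (simp add: filterlim_at)
          then have "eventually (\<lambda>m. c m * s < X s \<omega>) sequentially"
            using True by (intro order_tendstoD(2)) auto
          then show ?thesis
            by eventually_elim (use True \<omega> c_pos \<open>0 < s\<close> in \<open>simp add: less_imp_neq[symmetric]\<close>)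
        next
          case False
          then have "max (X s \<omega>) 0 - max (X s \<omega> - c m * s) 0 = 0" for m
            using mult_pos_pos[OF c_pos[of m] \<open>0 < s\<close>] by linarith
          then show ?thesis using False by simp
        qed
        then show "(\<lambda>m. (max (X s \<omega>) 0 - max (X s \<omega> - c m * s) 0) / s / c m)
              \<longlonglongrightarrow> indicator {\<omega> \<in> space M. X s \<omega> > 0} \<omega>"
          by (rule tendsto_eventually)
      qed
      show "AE \<omega> in M. norm ((max (X s \<omega>) 0 - max (X s \<omega> - c m * s) 0) / s / c m) \<le> 1" for m
        using quot by (intro AE_I2) (simp only: real_norm_def abs_of_nonneg)
    qed simp_all
    then show ?thesis by (simp add: ramp_rate_def p_def)
  qed
  have rate_meas: "(\<lambda>s. indicator {0<..t} s * (ramp_rate (c m) s / c m)) \<in> borel_measurable lborel" for m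
  proof -
    have "(\<lambda>s. indicator {0<..t} s * ramp_rate (c m) s / c m) \<in> borel_measurable lborel"
      using ramp_rate_measurable[OF \<open>t > 0\<close> less_imp_le[OF c_pos[of m]]]
      by (intro borel_measurable_divide borel_measurable_const) simp
    then show ?thesis by (simp only: times_divide_eq_right)
  qed
  have rate_lim: "(\<lambda>m. indicator {0<..t} s * (ramp_rate (c m) s / c m)) \<longlonglongrightarrow> indicator {0<..t} s * p s" for s
    using p_lim[of s] by (cases "s \<in> {0<..t}") (auto intro: tendsto_intros)
  have p_meas: "(\<lambda>s. indicator {0<..t} s * p s) \<in> borel_measurable lborel"
    by (rule borel_measurable_LIMSEQ_real[OF rate_lim rate_meas])
  have ind_int: "integrable lborel (\<lambda>s. indicator {0<..t} s :: real)"
    using \<open>t > 0\<close> by (auto simp: integrable_indicator_iff)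
  have rhs: "(\<lambda>m. \<integral>s. indicator {0<..t} s * (ramp_rate (c m) s / c m) \<partial>lborel)
        \<longlonglongrightarrow> (\<integral>s. indicator {0<..t} s * p s \<partial>lborel)"
  proof (rule integral_dominated_convergence[where w="indicator {0<..t}"])
    show "AE s in lborel. norm (indicator {0<..t} s * (ramp_rate (c m) s / c m)) \<le> indicator {0<..t} s" for m
      using ramp_rate_bounds[OF less_imp_le[OF c_pos[of m]]] c_pos[of m]
      by (intro AE_I2) (auto simp: indicator_def)
  qed (use rate_meas rate_lim p_meas ind_int in auto)
  have "(\<integral>\<omega>. sup_loss t (c m) \<omega> / c m \<partial>M)
      = (\<integral>s. indicator {0<..t} s * (ramp_rate (c m) s / c m) \<partial>lborel)" for m
    using expected_sup_loss[OF \<open>t > 0\<close> less_imp_le[OF c_pos[of m]]] by simp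
  with lhs rhs have eq: "(\<integral>\<omega>. \<tau> \<omega> \<partial>M) = (\<integral>s. indicator {0<..t} s * p s \<partial>lborel)"
    by (simp only: LIMSEQ_unique)
  have \<tau>_range: "0 \<le> \<tau> \<omega>" "\<tau> \<omega> \<le> t" if "\<omega> \<in> space M" for \<omega>
    using slope(1,2)[OF that] .
  have "(\<integral>\<^sup>+\<omega>. ennreal (\<tau> \<omega>) \<partial>M) = ennreal (\<integral>\<omega>. \<tau> \<omega> \<partial>M)"
    using \<tau>_range \<tau>_meas
    by (intro nn_integral_eq_integral integrable_const_bound[where B=t]) auto
  also have "\<dots> = (\<integral>\<^sup>+s. ennreal (indicator {0<..t} s * p s) \<partial>lborel)"
    unfolding eq
  proof (rule nn_integral_eq_integral[symmetric])
    show "integrable lborel (\<lambda>s. indicator {0<..t} s * p s)"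
      by (rule Bochner_Integration.integrable_bound[OF ind_int p_meas])
         (auto simp: indicator_def p_def)
  qed (auto simp: p_def)
  also have "\<dots> = (\<integral>\<^sup>+s\<in>{0<..t}. ennreal (p s) \<partial>lborel)"
    by (intro nn_integral_cong) (simp add: indicator_def)
  finally show ?thesis unfolding \<tau>_def p_def .
qed

text \<open>Let \<open>c\<close> tend to infinity in the comparison formula. Both sides increase, on the left to the running
supremum because \<^const>\<open>drifted_sup\<close> decreases to \<open>0\<close>, on the right to the positive part of \<open>X s\<close>
divided by \<open>s\<close>. Monotone convergence covers infinite expectations.\<close>

lemma expected_running_sup:
  assumes "t > 0"
  shows "(\<integral>\<^sup>+\<omega>. ennreal (running_sup X t \<omega>) \<partial>M) =
         (\<integral>\<^sup>+s\<in>{0<..t}. ((\<integral>\<^sup>+\<omega>. ennreal (max (X s \<omega>) 0) \<partial>M) / ennreal s) \<partial>lborel)"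
proof -
  have lhs: "(\<lambda>m. \<integral>\<^sup>+\<omega>. ennreal (sup_loss t (real m) \<omega>) \<partial>M) \<longlonglongrightarrow> (\<integral>\<^sup>+\<omega>. ennreal (running_sup X t \<omega>) \<partial>M)"
  proof -
    \<comment> \<open>Paths are only controlled on the sample space, whereas the monotone limit is needed at every point of the type; the indicator takes care of the rest.\<close>
    let ?u = "\<lambda>m \<omega>. ennreal (sup_loss t (real m) \<omega>) * indicator (space M) \<omega>"
    have "(\<lambda>m. integral\<^sup>N M (?u m)) \<longlonglongrightarrow> (\<integral>\<^sup>+\<omega>. ennreal (running_sup X t \<omega>) * indicator (space M) \<omega> \<partial>M)"
    proof (rule nn_integral_LIMSEQ)
      show "incseq ?u"
        unfolding sup_loss_def using \<open>t > 0\<close>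
        by (intro incseq_SucI le_funI)
           (auto simp: indicator_def intro!: ennreal_leI diff_left_mono drifted_sup_antimono cadlag_paths)
      show "?u m \<in> borel_measurable M" for m
        using sup_loss_measurable[OF \<open>t > 0\<close>, of "real m"] by simp
      fix \<omega>
      show "(\<lambda>m. ?u m \<omega>) \<longlonglongrightarrow> ennreal (running_sup X t \<omega>) * indicator (space M) \<omega>"
      proof (cases "\<omega> \<in> space M")
        case True
        have "(\<lambda>m. drifted_sup (\<lambda>s. X s \<omega>) t (real m)) \<longlonglongrightarrow> 0"
          using True \<open>t > 0\<close>
          by (intro filterlim_compose[OF drifted_sup_to_zero filterlim_real_sequentially] cadlag_paths start_zero) auto
        then have "(\<lambda>m. sup_loss t (real m) \<omega>) \<longlonglongrightarrow> running_sup X t \<omega> - 0"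
          unfolding sup_loss_def running_sup_eq by (intro tendsto_diff tendsto_const)
        then show ?thesis using True by (simp add: tendsto_ennrealI)
      qed simp
    qed
    moreover have "(\<integral>\<^sup>+\<omega>. f \<omega> * indicator (space M) \<omega> \<partial>M) = integral\<^sup>N M f" for f :: "'a \<Rightarrow> ennreal"
      by (intro nn_integral_cong) simp
    ultimately show ?thesis by simp
  qed
  have inner: "(\<lambda>m. ennreal (ramp_rate (real m) s)) \<longlonglongrightarrow> (\<integral>\<^sup>+\<omega>. ennreal (max (X s \<omega>) 0) \<partial>M) / ennreal s"
    if "0 < s" for s
  proof -
    note [measurable] = random_variable[OF less_imp_le[OF that]]
    let ?r = "\<lambda>m \<omega>. (max (X s \<omega>) 0 - max (X s \<omega> - real m * s) 0) / s"
    have "(\<lambda>m. \<integral>\<^sup>+\<omega>. ennreal (?r m \<omega>) \<partial>M) \<longlonglongrightarrow> (\<integral>\<^sup>+\<omega>. ennreal (max (X s \<omega>) 0 / s) \<partial>M)"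
    proof (rule nn_integral_LIMSEQ)
      show "incseq (\<lambda>m \<omega>. ennreal (?r m \<omega>))"
        using that by (intro incseq_SucI le_funI ennreal_leI divide_right_mono diff_left_mono max.mono)
          (auto simp: algebra_simps)
      fix \<omega>
      obtain N :: nat where N: "X s \<omega> / s \<le> real N" using real_arch_simple by blast
      have "eventually (\<lambda>m. ?r m \<omega> = max (X s \<omega>) 0 / s) sequentially"
        using eventually_ge_at_top[of N]
      proof eventually_elim
        case (elim m)
        then have "X s \<omega> \<le> real m * s"
          using N that by (metis divide_le_eq of_nat_le_iff order_trans)
        then show ?case by simp
      qed
      then show "(\<lambda>m. ennreal (?r m \<omega>)) \<longlonglongrightarrow> ennreal (max (X s \<omega>) 0 / s)"
        by (intro tendsto_ennrealI tendsto_eventually)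
    qed measurable
    moreover have "(\<integral>\<^sup>+\<omega>. ennreal (?r m \<omega>) \<partial>M) = ennreal (ramp_rate (real m) s)" for m
      unfolding ramp_rate_def
      by (intro nn_integral_eq_integral ramp_quotient_integrable AE_I2 ramp_quotient_bounds that) auto
    moreover have "(\<integral>\<^sup>+\<omega>. ennreal (max (X s \<omega>) 0 / s) \<partial>M) = (\<integral>\<^sup>+\<omega>. ennreal (max (X s \<omega>) 0) \<partial>M) / ennreal s"
          proof -
      have "ennreal (max (X s \<omega>) 0 / s) = ennreal (max (X s \<omega>) 0) / ennreal s" for \<omega>
        using that by (intro divide_ennreal[symmetric]) auto
      then have "(\<integral>\<^sup>+\<omega>. ennreal (max (X s \<omega>) 0 / s) \<partial>M) = (\<integral>\<^sup>+\<omega>. ennreal (max (X s \<omega>) 0) / ennreal s \<partial>M)"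
        by (simp only:)
      also have "\<dots> = (\<integral>\<^sup>+\<omega>. ennreal (max (X s \<omega>) 0) \<partial>M) / ennreal s"
        by (rule nn_integral_divide) measurable
      finally show ?thesis .
    qed
    ultimately show ?thesis by simp
  qed
  have rate_mono: "ramp_rate (real m) s \<le> ramp_rate (real (Suc m)) s" if "0 < s" for m s
    unfolding ramp_rate_def using that
    by (intro integral_mono ramp_quotient_integrable divide_right_mono diff_left_mono max.mono)
       (auto simp: algebra_simps)
  have rhs: "(\<lambda>m. \<integral>\<^sup>+s. ennreal (indicator {0<..t} s * ramp_rate (real m) s) \<partial>lborel) \<longlonglongrightarrow>
     (\<integral>\<^sup>+s\<in>{0<..t}. ((\<integral>\<^sup>+\<omega>. ennreal (max (X s \<omega>) 0) \<partial>M) / ennreal s) \<partial>lborel)"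
  proof (rule nn_integral_LIMSEQ)
    show "incseq (\<lambda>m s. ennreal (indicator {0<..t} s * ramp_rate (real m) s))"
      using rate_mono by (intro incseq_SucI le_funI ennreal_leI) (auto simp: indicator_def)
    show "(\<lambda>s. ennreal (indicator {0<..t} s * ramp_rate (real m) s)) \<in> borel_measurable lborel" for m
      using ramp_rate_measurable[OF \<open>t > 0\<close>, of "real m"] by simp
    show "(\<lambda>m. ennreal (indicator {0<..t} s * ramp_rate (real m) s))
       \<longlonglongrightarrow> (\<integral>\<^sup>+\<omega>. ennreal (max (X s \<omega>) 0) \<partial>M) / ennreal s * indicator {0<..t} s" for s
      using inner[of s] by (cases "s \<in> {0<..t}") auto
  qed
  have "(\<integral>\<^sup>+\<omega>. ennreal (sup_loss t (real m) \<omega>) \<partial>M)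
      = (\<integral>\<^sup>+s. ennreal (indicator {0<..t} s * ramp_rate (real m) s) \<partial>lborel)" for m
  proof -
    have "(\<integral>\<^sup>+\<omega>. ennreal (sup_loss t (real m) \<omega>) \<partial>M) = ennreal (\<integral>\<omega>. sup_loss t (real m) \<omega> \<partial>M)"
    proof (rule nn_integral_eq_integral)
      show "integrable M (sup_loss t (real m))"
        using sup_loss_measurable[OF \<open>t > 0\<close>, of "real m"] sup_loss_bounds[of _ t "real m"] \<open>t > 0\<close>
        by (intro integrable_const_bound[where B="real m * t"]) auto
      show "AE \<omega> in M. 0 \<le> sup_loss t (real m) \<omega>"
        using sup_loss_bounds(1)[of _ t "real m"] \<open>t > 0\<close> by auto
    qed
    also have "\<dots> = ennreal (\<integral>s. indicator {0<..t} s * ramp_rate (real m) s \<partial>lborel)"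
      using expected_sup_loss[OF \<open>t > 0\<close>, of "real m"] by simp
    also have "\<dots> = (\<integral>\<^sup>+s. ennreal (indicator {0<..t} s * ramp_rate (real m) s) \<partial>lborel)"
    proof (rule nn_integral_eq_integral[symmetric])
      have "integrable lborel (\<lambda>s. real m * indicator {0<..t} s)"
        using \<open>t > 0\<close> by (intro integrable_mult_right) (auto simp: integrable_indicator_iff)
      then show "integrable lborel (\<lambda>s. indicator {0<..t} s * ramp_rate (real m) s)"
        by (rule Bochner_Integration.integrable_bound)
          (use ramp_rate_measurable[OF \<open>t > 0\<close>, of "real m"] ramp_rate_bounds[of "real m"] in
            \<open>auto simp: indicator_def\<close>)
      show "AE s in lborel. 0 \<le> indicator {0<..t} s * ramp_rate (real m) s"
        using ramp_rate_bounds(1)[of "real m"] by (intro AE_I2) (auto simp: indicator_def)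
    qed
    finally show ?thesis .
  qed
  with lhs rhs show ?thesis by (simp add: LIMSEQ_unique)
qed

end

theorem corollary3:
  fixes M :: "'a measure" and X :: "real \<Rightarrow> 'a \<Rightarrow> real" and t :: real
  assumes "levy_process M X" and "t > 0"
  shows "(\<integral>\<^sup>+\<omega>. ennreal (time_of_sup X t \<omega>) \<partial>M) =
           (\<integral>\<^sup>+s\<in>{0<..t}. ennreal \<P>(\<omega> in M. X s \<omega> > 0) \<partial>lborel) \<and>
         (\<integral>\<^sup>+\<omega>. ennreal (running_sup X t \<omega>) \<partial>M) =
           (\<integral>\<^sup>+s\<in>{0<..t}. ((\<integral>\<^sup>+\<omega>. ennreal (max (X s \<omega>) 0) \<partial>M) / ennreal s) \<partial>lborel)"
proof -
  interpret levy_process M X by fact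
  show ?thesis
    using expected_time_of_sup[OF \<open>t > 0\<close>] expected_running_sup[OF \<open>t > 0\<close>] by blast
qed

end
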